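(* Let $G$ be a connected graph without isolated vertices (i.e. with at least two vertices). Then (1) $\chi_{ON}(G)\le 2\,\mathrm{tw}(G)+1$; (2) $\chi_{ON}(G)\le \mathrm{fvs}(G)+3$; (3) $\chi_{ON}(G)\le \mathrm{vc}(G)+1$, and if moreover $G$ is neither a star graph nor an edge-star graph, then $\chi_{ON}(G)\le\mathrm{vc}(G)$.
   Context: A $q$-ONCF-coloring of a graph $G$ is a map $c\colon V(G)\to\{1,\dots,q\}$ such that for every vertex $v$ the open neighborhood $N(v)$ contains a vertex $u$ with $c(u)\neq c(w)$ for all $w\in N(v)\setminus\{u\}$. $\chi_{ON}(G)$ is the minimum $q$ for which $G$ has a $q$-ONCF-coloring. $\mathrm{tw}(G)$, $\mathrm{fvs}(G)$, $\mathrm{vc}(G)$ denote the treewidth, the size of a minimum feedback vertex set, and the size of a minimum vertex cover of $G$. An edge-star graph is a graph with a central edge $\{u,v\}$ such that every other vertex $w$ has $N(w)=\{u,v\}$ (e.g. a triangle). *)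

theory Defs
  imports "Graph_Theory.Digraph_Component"
begin

text \<open>
  Finite simple undirected graphs are represented by the locale \<^locale>\<open>pair_graph\<close>: finite,
  loop-free, symmetric digraphs whose arcs are pairs of vertices.
\<close>

definition open_nbhd :: "'a pair_pre_digraph \<Rightarrow> 'a \<Rightarrow> 'a set" where
  "open_nbhd G v = {u. (v, u) \<in> parcs G}"

definition oncf_coloring :: "'a pair_pre_digraph \<Rightarrow> nat \<Rightarrow> ('a \<Rightarrow> nat) \<Rightarrow> bool" where
  "oncf_coloring G q c \<longleftrightarrow>
     (\<forall>v\<in>pverts G. c v \<in> {1..q}) \<and>
     (\<forall>v\<in>pverts G. \<exists>u\<in>open_nbhd G v. \<forall>w\<in>open_nbhd G v - {u}. c u \<noteq> c w)"

definition chi_ON :: "'a pair_pre_digraph \<Rightarrow> nat" where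
  "chi_ON G = (LEAST q. \<exists>c. oncf_coloring G q c)"

text \<open>
  The library's \<^const>\<open>forest\<close> and \<^const>\<open>tree\<close> count the closed walk \<open>u, v, u\<close> in a
  symmetric digraph as a cycle. A cycle of an undirected graph has length at least three.
\<close>

definition undirected_forest :: "('a, 'b) pre_digraph \<Rightarrow> bool" where
  "undirected_forest G \<longleftrightarrow> \<not> (\<exists>p. pre_digraph.cycle G p \<and> 3 \<le> length p)"

definition undirected_tree :: "('a, 'b) pre_digraph \<Rightarrow> bool" where
  "undirected_tree G \<longleftrightarrow> Digraph_Component.connected G \<and> undirected_forest G"

definition tree_decomposition ::
    "'a pair_pre_digraph \<Rightarrow> 't pair_pre_digraph \<Rightarrow> ('t \<Rightarrow> 'a set) \<Rightarrow> bool" where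
  "tree_decomposition G T X \<longleftrightarrow>
     pair_graph T \<and> undirected_tree (with_proj T) \<and>
     (\<Union>t\<in>pverts T. X t) = pverts G \<and>
     (\<forall>(u, v)\<in>parcs G. \<exists>t\<in>pverts T. u \<in> X t \<and> v \<in> X t) \<and>
     (\<forall>v\<in>pverts G. Digraph_Component.connected (with_proj T \<restriction> {t \<in> pverts T. v \<in> X t}))"

definition decomposition_width :: "'t pair_pre_digraph \<Rightarrow> ('t \<Rightarrow> 'a set) \<Rightarrow> nat" where
  "decomposition_width T X = Max ((\<lambda>t. card (X t)) ` pverts T) - 1"

text \<open>
  The tree of a decomposition is finite, so its nodes may be taken to be natural numbers. The
  truncated subtraction in the width matters only for the graph without vertices.
\<close>

definition treewidth :: "'a pair_pre_digraph \<Rightarrow> nat" where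
  "treewidth G = (LEAST k. \<exists>(T :: nat pair_pre_digraph) X.
     tree_decomposition G T X \<and> decomposition_width T X = k)"

definition feedback_vertex_set :: "'a pair_pre_digraph \<Rightarrow> 'a set \<Rightarrow> bool" where
  "feedback_vertex_set G S \<longleftrightarrow>
     S \<subseteq> pverts G \<and> undirected_forest (with_proj G \<restriction> (pverts G - S))"

definition fvs :: "'a pair_pre_digraph \<Rightarrow> nat" where
  "fvs G = (LEAST k. \<exists>S. feedback_vertex_set G S \<and> card S = k)"

definition vertex_cover :: "'a pair_pre_digraph \<Rightarrow> 'a set \<Rightarrow> bool" where
  "vertex_cover G S \<longleftrightarrow> S \<subseteq> pverts G \<and> (\<forall>(u, v)\<in>parcs G. u \<in> S \<or> v \<in> S)"

definition vc :: "'a pair_pre_digraph \<Rightarrow> nat" where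
  "vc G = (LEAST k. \<exists>S. vertex_cover G S \<and> card S = k)"

definition star_graph :: "'a pair_pre_digraph \<Rightarrow> bool" where
  "star_graph G \<longleftrightarrow> (\<exists>u\<in>pverts G. \<forall>w\<in>pverts G - {u}. open_nbhd G w = {u})"

definition edge_star_graph :: "'a pair_pre_digraph \<Rightarrow> bool" where
  "edge_star_graph G \<longleftrightarrow>
     (\<exists>(u, v)\<in>parcs G. \<forall>w\<in>pverts G - {u, v}. open_nbhd G w = {u, v})"

text \<open>
  The minima above range over nonempty sets, so the \<^const>\<open>Least\<close> operators are meaningful.
\<close>

lemma ex_oncf_coloring:
  assumes "pair_graph G" "\<forall>v\<in>pverts G. open_nbhd G v \<noteq> {}"
  shows "\<exists>q c. oncf_coloring G q c"
proof -
  interpret pair_graph G by fact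
  obtain c :: "'a \<Rightarrow> nat" where c: "bij_betw c (pverts G) {1..card (pverts G)}"
    using pair_finite_verts finite_same_card_bij[of "pverts G" "{1..card (pverts G)}"] by auto
  have sub: "open_nbhd G v \<subseteq> pverts G" for v
    by (auto simp: open_nbhd_def dest: in_arcsD2)
  have "oncf_coloring G (card (pverts G)) c"
    unfolding oncf_coloring_def
  proof (intro conjI ballI)
    fix v assume "v \<in> pverts G"
    then show "c v \<in> {1..card (pverts G)}" using c by (auto simp: bij_betw_def)
    obtain u where "u \<in> open_nbhd G v" using assms(2) \<open>v \<in> pverts G\<close> by blast
    then show "\<exists>u\<in>open_nbhd G v. \<forall>w\<in>open_nbhd G v - {u}. c u \<noteq> c w"
      using sub[of v] c unfolding bij_betw_def inj_on_def by blast
  qed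
  then show ?thesis by blast
qed

lemma undirected_forest_if_no_arcs:
  assumes "arcs H = {}"
  shows "undirected_forest H"
  using assms by (auto simp: undirected_forest_def pre_digraph.cycle_def pre_digraph.awalk_def)

lemma ex_tree_decomposition:
  assumes "pair_graph G"
  shows "\<exists>(T :: nat pair_pre_digraph) X. tree_decomposition G T X"
proof -
  interpret pair_graph G by fact
  let ?T = "\<lparr>pverts = {0::nat}, parcs = {}\<rparr>"
  have T: "pair_graph ?T"
    by unfold_locales (auto simp: symmetric_def sym_def)
  have conn: "Digraph_Component.connected H" if "verts H = {0}" for H :: "(nat, nat \<times> nat) pre_digraph"
    using that
    by (auto simp: Digraph_Component.connected_def strongly_connected_def mk_symmetric_def
        reachable_def intro: rtrancl_on_refl)
  have "tree_decomposition G ?T (\<lambda>_. pverts G)"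
    unfolding tree_decomposition_def undirected_tree_def
    using T by (auto intro!: conn undirected_forest_if_no_arcs dest: in_arcsD1 in_arcsD2)
  then show ?thesis by blast
qed

lemma feedback_vertex_set_verts: "feedback_vertex_set G (pverts G)"
  by (auto simp: feedback_vertex_set_def intro!: undirected_forest_if_no_arcs)

lemma vertex_cover_verts: "vertex_cover G (pverts G)" if "pair_graph G"
proof -
  interpret pair_graph G by fact
  show ?thesis by (auto simp: vertex_cover_def dest: in_arcsD1)
qed

end

theory Submission
  imports Defs
begin

text \<open>
  Choose for every vertex \<open>v\<close> a neighbour \<open>f v\<close> that is to be uniquely coloured in the neighbourhood
  of \<open>v\<close>. Then a vertex \<open>w\<close> only has to avoid the colours of \<open>f v\<close> for the neighbours \<open>v\<close> of \<open>w\<close> with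
  \<open>f v \<noteq> w\<close>.

  Treewidth: order the vertices by the topmost nodes of their subtrees and let \<open>f v\<close> be the earliest
  neighbour. A neighbour \<open>v\<close> of \<open>w\<close> either precedes \<open>w\<close>, or \<open>f v\<close> and \<open>w\<close> lie in the top bag of \<open>v\<close>; so
  \<open>v\<close> or \<open>f v\<close> lies in the top bag of \<open>w\<close>, and at most \<open>2 tw\<close> colours are forbidden at \<open>w\<close>.

  Feedback vertex set \<open>S\<close>: give the vertices of \<open>S\<close> distinct colours and colour the forest downwards
  from the roots. At each forest vertex every \<open>s \<in> S\<close> forbids at most one colour, the parent forbids
  one, and one reserved colour is set aside for leaves of degree two.

  Vertex cover \<open>S\<close>: give \<open>S\<close> distinct colours and colour the rest greedily. With \<open>card S\<close> colours this can
  fail only if some outer vertex is adjacent to all of \<open>S\<close>; the colour of that vertex is then chosen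
  according to the graph induced on \<open>S\<close>, which is settled directly unless it is a perfect matching.
\<close>

section \<open>Forests and greedy colourings\<close>

text \<open>Take a longest path in \<open>W\<close>. All neighbours of its first vertex within
  \<open>W\<close> lie on the path, and one of them is not the second vertex, so the arc back from
  there closes a cycle of length at least three.\<close>

lemma ex_cycle_if_two_neighbours:
  assumes "finite W" "W \<noteq> {}" "sym E" "irrefl E"
    and two: "\<And>v. v \<in> W \<Longrightarrow> \<exists>a\<in>W. \<exists>b\<in>W. a \<noteq> b \<and> (v, a) \<in> E \<and> (v, b) \<in> E"
  shows "\<exists>xs. 3 \<le> length xs \<and> distinct xs \<and> set xs \<subseteq> W \<and>
           successively (\<lambda>a b. (a, b) \<in> E) xs \<and> (last xs, hd xs) \<in> E"
proof -
  define P where "P xs \<longleftrightarrow> xs \<noteq> [] \<and> distinct xs \<and> set xs \<subseteq> W \<and>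
    successively (\<lambda>a b. (a, b) \<in> E) xs" for xs
  obtain w where "w \<in> W" using \<open>W \<noteq> {}\<close> by blast
  then have "P [w]" by (simp add: P_def)
  moreover have "length xs \<le> card W" if "P xs" for xs
    using that \<open>finite W\<close> by (metis P_def card_mono distinct_card)
  ultimately obtain xs where xs: "P xs" and max: "\<And>ys. P ys \<Longrightarrow> length ys \<le> length xs"
    using ex_has_greatest_nat[of P "[w]" length "Suc (card W)"] by (meson less_Suc_eq_le)
  obtain x ys where x: "xs = x # ys" using xs by (cases xs) (auto simp: P_def)
  have "x \<in> W" using xs by (simp add: P_def x)
  from two[OF this] obtain a b where ab: "a \<in> W" "b \<in> W" "a \<noteq> b" "(x, a) \<in> E" "(x, b) \<in> E"
    by blast
  have in_ys: "z \<in> set ys" if "z \<in> W" "(x, z) \<in> E" for z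
  proof (rule ccontr)
    assume "z \<notin> set ys"
    moreover have "z \<noteq> x" using that(2) \<open>irrefl E\<close> by (auto simp: irrefl_def)
    ultimately have "P (z # xs)"
      using xs that \<open>sym E\<close> by (auto simp: P_def x dest: symD)
    from max[OF this] show False by simp
  qed
  then obtain y zs where y: "ys = y # zs" using ab(1,4) by (cases ys) auto
  obtain z where z: "z \<in> W" "(x, z) \<in> E" "z \<noteq> y"
    using ab by metis
  then have "z \<in> set zs" using in_ys y by auto
  then obtain us vs where zs: "zs = us @ z # vs" by (meson split_list)
  let ?c = "x # y # us @ [z]"
  have eq: "xs = ?c @ vs" using x y zs by simp
  have "successively (\<lambda>a b. (a, b) \<in> E) ?c"
    using xs unfolding P_def eq successively_append_iff by blast
  moreover have "distinct ?c \<and> set ?c \<subseteq> W" using xs unfolding P_def eq by auto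
  moreover have "(last ?c, hd ?c) \<in> E" using z \<open>sym E\<close> by (auto dest: symD)
  moreover have "3 \<le> length ?c" by simp
  ultimately show ?thesis by blast
qed

text \<open>A vertex with at most one successor in \<open>U\<close> gets the largest number, and the
  rest is numbered by induction.\<close>

lemma ex_degenerate_numbering:
  assumes "finite U"
    and "\<And>W. W \<subseteq> U \<Longrightarrow> W \<noteq> {} \<Longrightarrow>
           \<exists>v\<in>W. \<forall>a\<in>W. \<forall>b\<in>W. (v, a) \<in> E \<longrightarrow> (v, b) \<in> E \<longrightarrow> a = b"
  shows "\<exists>idx :: 'a \<Rightarrow> nat. inj_on idx U \<and>
           (\<forall>v\<in>U. \<forall>a\<in>U. \<forall>b\<in>U. (v, a) \<in> E \<longrightarrow> (v, b) \<in> E \<longrightarrow>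
              idx a < idx v \<longrightarrow> idx b < idx v \<longrightarrow> a = b)"
  using assms
proof (induction "card U" arbitrary: U)
  case 0
  then show ?case by simp
next
  case (Suc n)
  then have "U \<noteq> {}" by auto
  then obtain v where v: "v \<in> U" "\<forall>a\<in>U. \<forall>b\<in>U. (v, a) \<in> E \<longrightarrow> (v, b) \<in> E \<longrightarrow> a = b"
    using Suc.prems(2)[of U] by blast
  have "n = card (U - {v})" using Suc.hyps(2) v(1) Suc.prems(1) by simp
  then have "\<exists>idx :: 'a \<Rightarrow> nat. inj_on idx (U - {v}) \<and>
      (\<forall>w\<in>U - {v}. \<forall>a\<in>U - {v}. \<forall>b\<in>U - {v}. (w, a) \<in> E \<longrightarrow> (w, b) \<in> E \<longrightarrow>
         idx a < idx w \<longrightarrow> idx b < idx w \<longrightarrow> a = b)"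
    using Suc.prems by (intro Suc.hyps(1)) auto
  then obtain idx :: "'a \<Rightarrow> nat" where inj: "inj_on idx (U - {v})"
    and idx: "\<And>w a b. w \<in> U - {v} \<Longrightarrow> a \<in> U - {v} \<Longrightarrow> b \<in> U - {v} \<Longrightarrow> (w, a) \<in> E \<Longrightarrow>
      (w, b) \<in> E \<Longrightarrow> idx a < idx w \<Longrightarrow> idx b < idx w \<Longrightarrow> a = b"
    by blast
  obtain m where m: "\<And>w. w \<in> U \<Longrightarrow> idx w < m"
    using finite_nat_set_iff_bounded[of "idx ` U"] Suc.prems(1) by auto
  define j where "j = idx(v := m)"
  have lt: "j w < j v" if "w \<in> U" "w \<noteq> v" for w using that m by (simp add: j_def)
  have "inj_on j U"
  proof (rule inj_onI)
    fix a b assume ab: "a \<in> U" "b \<in> U" "j a = j b"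
    then have "a = v \<longleftrightarrow> b = v" using lt[of a] lt[of b] by force
    then show "a = b" using ab inj by (auto simp: j_def inj_on_def split: if_splits)
  qed
  moreover have "a = b" if "w \<in> U" "a \<in> U" "b \<in> U" "(w, a) \<in> E" "(w, b) \<in> E" "j a < j w" "j b < j w"
    for w a b
  proof (cases "w = v")
    case True
    then show ?thesis using v(2) that by blast
  next
    case False
    then have "a \<noteq> v" "b \<noteq> v" using lt[of w] that by auto
    then show ?thesis using idx[of w a b] False that by (simp add: j_def)
  qed
  ultimately show ?case by blast
qed

text \<open>Passes from vertex lists to arc lists: the zip begins with the closing arc from
  \<open>last xs\<close> to \<open>hd xs\<close>, so the walk starts and ends at
  \<open>last xs\<close>.\<close>

lemma cycle_of_vertex_list:
  assumes "tail H = fst" "head H = snd" "set xs \<subseteq> verts H" "xs \<noteq> []" "distinct xs"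
    and "successively (\<lambda>a b. (a, b) \<in> arcs H) xs" "(last xs, hd xs) \<in> arcs H"
  shows "pre_digraph.cycle H (zip (last xs # xs) xs)"
proof -
  interpret pre_digraph H .
  have "set (zip (x # ys) ys) \<subseteq> arcs H \<and> cas x (zip (x # ys) ys) (last (x # ys)) \<and>
        awalk_verts x (zip (x # ys) ys) = x # ys"
    if "successively (\<lambda>a b. (a, b) \<in> arcs H) (x # ys)" for x ys
    using that
  proof (induction ys arbitrary: x)
    case (Cons y ys)
    then show ?case using assms(1,2) Cons.IH[of y] by auto
  qed simp
  from this[of "last xs" xs] show ?thesis
    using assms by (auto simp: cycle_def awalk_def successively_Cons subset_iff intro!: exI[of _ "last xs"])
qed

text \<open>Forests are 1-degenerate, since a nonempty vertex set with two inner neighbours at each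
  vertex contains a cycle. The numbering amounts to a choice of roots: the neighbour with a smaller
  number is the parent.\<close>

lemma forest_numbering:
  assumes "tail H = fst" "head H = snd" "finite (verts H)" "sym (arcs H)" "irrefl (arcs H)"
    and "undirected_forest H"
  obtains idx :: "'a \<Rightarrow> nat" where "inj_on idx (verts H)"
    and "\<And>v a b. v \<in> verts H \<Longrightarrow> a \<in> verts H \<Longrightarrow> b \<in> verts H \<Longrightarrow> (v, a) \<in> arcs H \<Longrightarrow>
           (v, b) \<in> arcs H \<Longrightarrow> idx a < idx v \<Longrightarrow> idx b < idx v \<Longrightarrow> a = b"
proof -
  have "\<exists>v\<in>W. \<forall>a\<in>W. \<forall>b\<in>W. (v, a) \<in> arcs H \<longrightarrow> (v, b) \<in> arcs H \<longrightarrow> a = b"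
    if W: "W \<subseteq> verts H" "W \<noteq> {}" for W
  proof (rule ccontr)
    assume "\<not> ?thesis"
    then have two: "\<And>v. v \<in> W \<Longrightarrow> \<exists>a\<in>W. \<exists>b\<in>W. a \<noteq> b \<and> (v, a) \<in> arcs H \<and> (v, b) \<in> arcs H"
      by blast
    have "finite W" using W assms(3) finite_subset by blast
    from ex_cycle_if_two_neighbours[OF this W(2) assms(4,5) two]
    obtain xs where xs: "3 \<le> length xs" "distinct xs" "set xs \<subseteq> W"
      "successively (\<lambda>a b. (a, b) \<in> arcs H) xs" "(last xs, hd xs) \<in> arcs H" by blast
    then have "pre_digraph.cycle H (zip (last xs # xs) xs)"
      using W(1) by (intro cycle_of_vertex_list assms) auto
    moreover have "3 \<le> length (zip (last xs # xs) xs)" using xs(1) by simp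
    ultimately show False using assms(6) by (auto simp: undirected_forest_def)
  qed
  from ex_degenerate_numbering[OF assms(3), of "arcs H", OF this] show ?thesis
    using that by blast
qed

text \<open>Recursion along \<open>r\<close>: fewer than \<open>q\<close> forbidden colours always
  leave one free. The colours in \<open>pre\<close> are fixed in advance, and by
  \<open>local\<close> vertices of equal rank can be coloured independently.\<close>

lemma greedy_coloring:
  fixes r :: "'a \<Rightarrow> nat" and Forb :: "('a \<Rightarrow> nat) \<Rightarrow> 'a \<Rightarrow> nat set"
  assumes local: "\<And>c c' x. x \<in> A \<Longrightarrow> (\<And>y. y \<notin> A \<or> r y < r x \<Longrightarrow> c y = c' y) \<Longrightarrow>
      Forb c x = Forb c' x"
    and card: "\<And>c x. x \<in> A \<Longrightarrow> finite (Forb c x) \<and> card (Forb c x) < q"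
  shows "\<exists>c. (\<forall>y. y \<notin> A \<longrightarrow> c y = pre y) \<and> (\<forall>x\<in>A. c x \<in> {1..q} - Forb c x)"
proof -
  \<comment> \<open>Vertices of \<open>A\<close> not yet coloured read as 0, so that the functional
    consults \<open>rec\<close> only below \<open>x\<close>; by \<open>local\<close> this dummy
    value does not affect \<open>Forb\<close>.\<close>
  define F where "F rec x = (SOME i. i \<in> {1..q} - Forb (\<lambda>y. if y \<in> A then if r y < r x then rec y else 0 else pre y) x)"
    for rec x
  define g where "g = wfrec (measure r) F"
  define c where "c = (\<lambda>y. if y \<in> A then g y else pre y)"
  have g: "g x = F g x" for x
  proof -
    have "adm_wf (measure r) F"
      by (auto simp: adm_wf_def F_def cong: if_cong)
    then show ?thesis using wfrec_fixpoint[of "measure r" F] by (metis g_def wf_measure)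
  qed
  have "c x \<in> {1..q} - Forb c x" if x: "x \<in> A" for x
  proof -
    let ?c = "\<lambda>y. if y \<in> A then if r y < r x then g y else 0 else pre y"
    have eq: "Forb ?c x = Forb c x" by (rule local[OF x]) (auto simp: c_def)
    have "\<not> {1..q} \<subseteq> Forb c x"
      using card[OF x, of c] card_mono[of "Forb c x" "{1..q}"] by auto
    then have "\<exists>i. i \<in> {1..q} - Forb c x" by blast
    from someI_ex[OF this] show ?thesis using x eq g[of x] by (simp add: c_def F_def)
  qed
  then show ?thesis by (intro exI[of _ c]) (simp add: c_def)
qed

section \<open>Subtrees of a rooted forest\<close>

lemma connected_induced_exit:
  assumes "pair_graph T" "Digraph_Component.connected (with_proj T \<restriction> A)"
    and "x \<in> A" "x \<in> C" "y \<in> A" "y \<notin> C"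
  obtains u v where "u \<in> A" "u \<in> C" "v \<in> A" "v \<notin> C" "(u, v) \<in> parcs T"
proof -
  interpret pair_graph T by fact
  let ?M = "mk_symmetric (with_proj T \<restriction> A)"
  have arc: "(u, v) \<in> parcs T" if "(u, v) \<in> parcs ?M" for u v
    using that pair_sym_arcs by (auto simp: parcs_mk_symmetric symmetric_def dest: symD)
  have "(x, y) \<in> rtrancl_on A (parcs ?M)"
    using assms(2-5)
    by (auto simp: Digraph_Component.connected_def strongly_connected_def reachable_def)
  then have "y \<notin> C \<longrightarrow> (\<exists>u v. u \<in> A \<and> u \<in> C \<and> v \<in> A \<and> v \<notin> C \<and> (u, v) \<in> parcs T)"
    by (induction rule: rtrancl_on_induct) (use assms(4) arc in blast)+
  then show ?thesis using that assms(6) by blast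
qed

text \<open>Let \<open>D\<close> be the descendants of \<open>b\<close>, reached along increasing
  numbers. The only way out of \<open>D\<close> leads from \<open>b\<close> to its parent. As
  \<open>b\<close> is the top of \<open>B\<close>, all of \<open>B\<close> lies in \<open>D\<close>,
  and so does \<open>s\<close>. Hence \<open>A\<close> meets \<open>D\<close> and also reaches as
  high as \<open>b\<close>, which it can do only through \<open>b\<close>.\<close>

lemma top_mem_if_subtrees_meet:
  fixes idx :: "'t \<Rightarrow> nat"
  assumes T: "pair_graph T"
    and inj: "inj_on idx (pverts T)"
    and parent: "\<And>v a b. (v, a) \<in> parcs T \<Longrightarrow> (v, b) \<in> parcs T \<Longrightarrow>
           idx a < idx v \<Longrightarrow> idx b < idx v \<Longrightarrow> a = b"
    and A: "Digraph_Component.connected (with_proj T \<restriction> A)" "A \<subseteq> pverts T"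
    and B: "Digraph_Component.connected (with_proj T \<restriction> B)" "B \<subseteq> pverts T"
    and meet: "s \<in> A" "s \<in> B"
    and b: "b \<in> B" "\<And>x. x \<in> B \<Longrightarrow> idx b \<le> idx x"
    and a: "a \<in> A" "idx a \<le> idx b"
  shows "b \<in> A"
proof -
  interpret pair_graph T by fact
  define D where "D = {x. (b, x) \<in> {(x, y). (x, y) \<in> parcs T \<and> idx x < idx y}\<^sup>*}"
  have bD: "b \<in> D" by (simp add: D_def)
  have step: "y \<in> D" if "x \<in> D" "(x, y) \<in> parcs T" "idx x < idx y" for x y
    using that unfolding D_def by (auto intro: rtrancl_into_rtrancl)
  have idx_ge: "idx b \<le> idx x" if "x \<in> D" for x
  proof -
    have "(b, x) \<in> {(x, y). (x, y) \<in> parcs T \<and> idx x < idx y}\<^sup>*" using that by (simp add: D_def)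
    then show ?thesis by induction auto
  qed
  have exit: "x = b \<and> idx y < idx b" if x: "x \<in> D" and y: "y \<notin> D" "(x, y) \<in> parcs T" for x y
  proof -
    have "x \<noteq> y" using x y by auto
    moreover have "x \<in> pverts T" "y \<in> pverts T" using y in_arcsD1 in_arcsD2 by blast+
    ultimately have "idx x \<noteq> idx y" using inj by (auto simp: inj_on_def)
    then have lt: "idx y < idx x" using step[OF x y(2)] y(1) by linarith
    have "x = b"
    proof (rule ccontr)
      assume "x \<noteq> b"
      then obtain z where z: "z \<in> D" "(z, x) \<in> parcs T" "idx z < idx x"
        using x unfolding D_def by (auto elim: rtranclE)
      then have "(x, z) \<in> parcs T" using pair_sym_arcs by (auto simp: symmetric_def dest: symD)
      then have "z = y" using parent y(2) z(3) lt by blast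
      then show False using z(1) y(1) by simp
    qed
    then show ?thesis using lt by simp
  qed
  have "B \<subseteq> D"
  proof (rule ccontr)
    assume "\<not> B \<subseteq> D"
    then obtain y where "y \<in> B" "y \<notin> D" by blast
    from connected_induced_exit[OF T B(1) b(1) bD this] obtain u v
      where "u \<in> D" "v \<in> B" "v \<notin> D" "(u, v) \<in> parcs T" by metis
    then show False using exit[of u v] b(2)[of v] by simp
  qed
  then have sD: "s \<in> D" using meet by blast
  show ?thesis
  proof (cases "a \<in> D")
    case True
    then have "idx a = idx b" using idx_ge a(2) by force
    then have "a = b" using inj a(1) b(1) A(2) B(2) by (auto simp: inj_on_def)
    then show ?thesis using a(1) by simp
  next
    case False
    from connected_induced_exit[OF T A(1) meet(1) sD a(1) this] show ?thesis
      using exit by metis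
  qed
qed

context pair_graph
begin

section \<open>Earliest neighbours\<close>

lemma chi_ON_le: "oncf_coloring G q c \<Longrightarrow> chi_ON G \<le> q"
  unfolding chi_ON_def by (auto intro: Least_le)

lemma nbhd_sym: "u \<in> open_nbhd G v \<Longrightarrow> v \<in> open_nbhd G u"
  using pair_sym_arcs by (auto simp: open_nbhd_def symmetric_def dest: symD)

lemma nbhd_verts: "u \<in> open_nbhd G v \<Longrightarrow> u \<in> pverts G"
  by (auto simp: open_nbhd_def dest: in_arcsD2)

lemma not_in_own_nbhd: "v \<notin> open_nbhd G v"
  using pair_no_loops by (force simp: open_nbhd_def)

lemma finite_nbhd: "finite (open_nbhd G v)"
  using nbhd_verts pair_finite_verts by (meson finite_subset subsetI)

lemma ex_vertex_numbering:
  "\<exists>r :: 'a \<Rightarrow> nat. inj_on r (pverts G) \<and> (\<forall>v\<in>pverts G. r v < card (pverts G))"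
  using ex_bij_betw_finite_nat[OF pair_finite_verts]
  by (metis atLeastLessThan_iff bij_betw_imp_inj_on bij_betwE)

lemma ex_earliest_neighbour:
  fixes r :: "'a \<Rightarrow> nat"
  assumes "inj_on r (pverts G)" "\<forall>v\<in>pverts G. open_nbhd G v \<noteq> {}"
  obtains f where "\<And>v. v \<in> pverts G \<Longrightarrow> f v \<in> open_nbhd G v"
    and "\<And>v u. v \<in> pverts G \<Longrightarrow> u \<in> open_nbhd G v \<Longrightarrow> u \<noteq> f v \<Longrightarrow> r (f v) < r u"
proof -
  define f where "f v = arg_min_on r (open_nbhd G v)" for v
  have f: "f v \<in> open_nbhd G v" "\<And>u. u \<in> open_nbhd G v \<Longrightarrow> r (f v) \<le> r u"
    if "v \<in> pverts G" for v
    using arg_min_if_finite[OF finite_nbhd, of v r] assms(2) that unfolding f_def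
    by (auto simp: not_less)
  have "r (f v) < r u" if "v \<in> pverts G" "u \<in> open_nbhd G v" "u \<noteq> f v" for u v
  proof -
    have "r (f v) \<noteq> r u"
      using inj_onD[OF assms(1), of "f v" u] f(1)[OF that(1)] that(2,3) nbhd_verts by blast
    then show ?thesis using f(2)[OF that(1,2)] by simp
  qed
  then show ?thesis using that[of f] f(1) by blast
qed

text \<open>
  As the uniquely coloured neighbour of \<open>v\<close> is its earliest one, each conflict forces a vertex to
  avoid the colour of an earlier vertex, so a greedy colouring works.
\<close>

lemma chi_ON_le_if_few_earliest_neighbours:
  fixes r :: "'a \<Rightarrow> nat"
  assumes f: "\<And>v. v \<in> pverts G \<Longrightarrow> f v \<in> open_nbhd G v"
    and r: "\<And>v u. v \<in> pverts G \<Longrightarrow> u \<in> open_nbhd G v \<Longrightarrow> u \<noteq> f v \<Longrightarrow> r (f v) < r u"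
    and card: "\<And>w. w \<in> pverts G \<Longrightarrow> card (f ` {v \<in> open_nbhd G w. f v \<noteq> w}) < q"
  shows "chi_ON G \<le> q"
proof -
  let ?Forb = "\<lambda>c x. c ` f ` {v \<in> open_nbhd G x. f v \<noteq> x}"
  have fin: "finite (f ` {v \<in> open_nbhd G x. f v \<noteq> x})" for x
    using finite_nbhd by simp
  have local: "?Forb c x = ?Forb c' x"
    if "x \<in> pverts G" "\<And>y. y \<notin> pverts G \<or> r y < r x \<Longrightarrow> c y = c' y" for c c' :: "'a \<Rightarrow> nat" and x
  proof (rule image_cong[OF refl])
    fix y assume "y \<in> f ` {v \<in> open_nbhd G x. f v \<noteq> x}"
    then obtain v where v: "v \<in> open_nbhd G x" "f v \<noteq> x" "y = f v" by blast
    then show "c y = c' y" using r[of v x] nbhd_sym nbhd_verts that(2) by metis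
  qed
  have few: "finite (?Forb c x) \<and> card (?Forb c x) < q" if "x \<in> pverts G" for c :: "'a \<Rightarrow> nat" and x
    using card[OF that] card_image_le[OF fin[of x], of c] fin[of x] by auto
  have "\<exists>c. (\<forall>y. y \<notin> pverts G \<longrightarrow> c y = (0 :: nat)) \<and>
      (\<forall>x\<in>pverts G. c x \<in> {1..q} - ?Forb c x)"
    by (rule greedy_coloring[where r = r]) (fact local, fact few)
  then obtain c :: "'a \<Rightarrow> nat" where "\<forall>x\<in>pverts G. c x \<in> {1..q} - ?Forb c x"
    by (elim exE conjE)
  then have c: "c x \<in> {1..q} - ?Forb c x" if "x \<in> pverts G" for x
    using that by (rule bspec)
  have "oncf_coloring G q c" unfolding oncf_coloring_def
  proof (intro conjI ballI)
    fix v assume v: "v \<in> pverts G"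
    then show "c v \<in> {1..q}" using c by blast
    have "c (f v) \<noteq> c w" if "w \<in> open_nbhd G v - {f v}" for w
    proof -
      have "c (f v) \<in> ?Forb c w" using that nbhd_sym by blast
      then show ?thesis using c[of w] that nbhd_verts by (metis DiffD1 DiffD2)
    qed
    then show "\<exists>u\<in>open_nbhd G v. \<forall>w\<in>open_nbhd G v - {u}. c u \<noteq> c w"
      using f[OF v] by blast
  qed
  then show ?thesis by (rule chi_ON_le)
qed

section \<open>Treewidth\<close>

lemma chi_ON_le_decomposition_width:
  assumes dec: "tree_decomposition G T X" and noniso: "\<forall>v\<in>pverts G. open_nbhd G v \<noteq> {}"
  shows "chi_ON G \<le> 2 * decomposition_width T X + 1"
proof -
  define Tv where "Tv v = {t \<in> pverts T. v \<in> X t}" for v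
  let ?k = "decomposition_width T X"
  have T: "pair_graph T" and forest: "undirected_forest (with_proj T)"
    and cover: "(\<Union>t\<in>pverts T. X t) = pverts G"
    and edge: "\<And>u v. u \<in> open_nbhd G v \<Longrightarrow> \<exists>t\<in>pverts T. u \<in> X t \<and> v \<in> X t"
    and conn: "\<And>v. v \<in> pverts G \<Longrightarrow> Digraph_Component.connected (with_proj T \<restriction> Tv v)"
    using dec unfolding tree_decomposition_def undirected_tree_def Tv_def
    by (auto simp: open_nbhd_def)
  interpret T: pair_graph T by fact
  have symT: "sym (parcs T)" "irrefl (parcs T)"
    using T.pair_sym_arcs T.pair_no_loops[of "(a, a)" for a] by (auto simp: symmetric_def irrefl_def)
  obtain idx :: "'b \<Rightarrow> nat" where inj: "inj_on idx (pverts T)"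
    and parent: "\<And>v a b. (v, a) \<in> parcs T \<Longrightarrow> (v, b) \<in> parcs T \<Longrightarrow>
           idx a < idx v \<Longrightarrow> idx b < idx v \<Longrightarrow> a = b"
    using forest_numbering[of "with_proj T"] symT forest T.pair_finite_verts T.in_arcsD1 T.in_arcsD2
    by (metis with_proj_simps(1,2,4,5))
  have "\<exists>t. t \<in> Tv v \<and> (\<forall>s\<in>Tv v. idx t \<le> idx s)" if "v \<in> pverts G" for v
  proof -
    have "v \<in> (\<Union>t\<in>pverts T. X t)" using that cover by simp
    then obtain t where "t \<in> Tv v" unfolding Tv_def by blast
    from ex_has_least_nat[of "\<lambda>t. t \<in> Tv v", OF this, of idx] show ?thesis by blast
  qed
  then obtain top where top: "\<And>v. v \<in> pverts G \<Longrightarrow> top v \<in> Tv v"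
    and top_le: "\<And>v s. v \<in> pverts G \<Longrightarrow> s \<in> Tv v \<Longrightarrow> idx (top v) \<le> idx s" by metis
  obtain r0 :: "'a \<Rightarrow> nat" where r0: "inj_on r0 (pverts G)" "\<And>v. v \<in> pverts G \<Longrightarrow> r0 v < card (pverts G)"
    using ex_vertex_numbering by blast
  define n where "n = card (pverts G)"
  \<comment> \<open>Lexicographic order by the top node and then \<open>r0\<close>; as
    \<open>r0 v < n\<close>, the second summand never outweighs a step of
    \<open>idx\<close>.\<close>
  define r where "r v = idx (top v) * n + r0 v" for v
  have r_top: "idx (top u) \<le> idx (top v)" if "u \<in> pverts G" "v \<in> pverts G" "r u \<le> r v" for u v
  proof (rule ccontr)
    assume "\<not> ?thesis"
    then have "(idx (top v) + 1) * n \<le> idx (top u) * n" by (intro mult_right_mono) auto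
    then show False using that r0(2)[of v] by (simp add: r_def n_def)
  qed
  have "inj_on r (pverts G)"
  proof (rule inj_onI)
    fix u v assume uv: "u \<in> pverts G" "v \<in> pverts G" "r u = r v"
    then have "idx (top u) = idx (top v)" using r_top[of u v] r_top[of v u] by simp
    then show "u = v" using uv r0(1) by (auto simp: r_def inj_on_def)
  qed
  then obtain f where f: "\<And>v. v \<in> pverts G \<Longrightarrow> f v \<in> open_nbhd G v"
    and fr: "\<And>v u. v \<in> pverts G \<Longrightarrow> u \<in> open_nbhd G v \<Longrightarrow> u \<noteq> f v \<Longrightarrow> r (f v) < r u"
    using ex_earliest_neighbour noniso by metis
  \<comment> \<open>The subtrees of two vertices sharing a bag meet, and that of the earlier vertex
    reaches at least as high, so it contains the top node of the later one.\<close>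
  have key: "u \<in> X (top w)"
    if "u \<in> pverts G" "w \<in> pverts G" "r u \<le> r w" "t \<in> pverts T" "u \<in> X t" "w \<in> X t" for u w t
  proof -
    have "top w \<in> Tv u"
    proof (rule top_mem_if_subtrees_meet[OF T inj parent])
      show "Digraph_Component.connected (with_proj T \<restriction> Tv u)"
        "Digraph_Component.connected (with_proj T \<restriction> Tv w)" using conn that by auto
      show "t \<in> Tv u" "t \<in> Tv w" "top w \<in> Tv w" "top u \<in> Tv u"
        using top that by (auto simp: Tv_def)
      show "idx (top w) \<le> idx x" if "x \<in> Tv w" for x
        using top_le \<open>w \<in> pverts G\<close> that by blast
      show "idx (top u) \<le> idx (top w)" using r_top that by blast
    qed (auto simp: Tv_def)
    then show ?thesis by (simp add: Tv_def)
  qed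
  have "card (f ` {v \<in> open_nbhd G w. f v \<noteq> w}) < 2 * ?k + 1" if w: "w \<in> pverts G" for w
  proof -
    \<comment> \<open>Removing \<open>w\<close> from its top bag accounts for the \<open>- 1\<close>
      in the width.\<close>
    let ?Y = "X (top w) - {w}"
    have topT: "top w \<in> pverts T" "w \<in> X (top w)" using top[OF w] by (auto simp: Tv_def)
    have fin: "finite (X (top w))"
      using topT(1) cover pair_finite_verts by (metis UN_upper finite_subset)
    have "card (X (top w)) \<le> Max ((\<lambda>t. card (X t)) ` pverts T)"
      using topT(1) T.pair_finite_verts by (intro Max_ge) auto
    then have cardY: "card ?Y \<le> ?k"
      using fin topT(2) by (simp add: decomposition_width_def)
    have "f ` {v \<in> open_nbhd G w. f v \<noteq> w} \<subseteq> f ` ?Y \<union> ?Y"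
    proof clarify
      fix v assume v: "v \<in> open_nbhd G w" "f v \<noteq> w" "f v \<notin> ?Y"
      have vG: "v \<in> pverts G" and wv: "w \<in> open_nbhd G v" using v(1) nbhd_verts nbhd_sym by blast+
      have fvw: "r (f v) < r w" using fr[OF vG wv] v(2) by metis
      obtain t where t: "t \<in> pverts T" "v \<in> X t" "w \<in> X t" using edge[OF v(1)] by blast
      have "v \<noteq> w" using v(1) not_in_own_nbhd by metis
      show "f v \<in> f ` ?Y"
      proof (cases "r v \<le> r w")
        case True
        then show ?thesis using key[OF vG w True t] \<open>v \<noteq> w\<close> by blast
      next
        case False
        \<comment> \<open>Here \<open>f v\<close> precedes \<open>w\<close> and \<open>w\<close>
          precedes \<open>v\<close>, so both lie in the top bag of \<open>v\<close>; sharing that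
          bag puts \<open>f v\<close> into the top bag of \<open>w\<close>.\<close>
        obtain t' where t': "t' \<in> pverts T" "f v \<in> X t'" "v \<in> X t'" using edge[OF f[OF vG]] by blast
        have fvG: "f v \<in> pverts G" using f[OF vG] nbhd_verts by blast
        have "f v \<in> X (top v)" using key[OF fvG vG _ t'] False fvw by simp
        moreover have "w \<in> X (top v)" using key[OF w vG _ t(1,3,2)] False by simp
        moreover have "top v \<in> pverts T" using top[OF vG] by (simp add: Tv_def)
        ultimately have "f v \<in> X (top w)" using key[OF fvG w] fvw by simp
        then show ?thesis using v(2,3) by blast
      qed
    qed
    then have "card (f ` {v \<in> open_nbhd G w. f v \<noteq> w}) \<le> card (f ` ?Y \<union> ?Y)"
      using fin by (intro card_mono) auto
    also have "\<dots> \<le> card (f ` ?Y) + card ?Y" by (rule card_Un_le)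
    also have "\<dots> \<le> 2 * ?k" using cardY card_image_le[of ?Y f] fin by simp
    finally show ?thesis by simp
  qed
  then show ?thesis using chi_ON_le_if_few_earliest_neighbours[of f r] f fr by blast
qed

lemma chi_ON_le_treewidth:
  assumes "\<forall>v\<in>pverts G. open_nbhd G v \<noteq> {}"
  shows "chi_ON G \<le> 2 * treewidth G + 1"
proof -
  have "\<exists>k. \<exists>(T :: nat pair_pre_digraph) X. tree_decomposition G T X \<and> decomposition_width T X = k"
    using ex_tree_decomposition[OF pair_graph_axioms] by blast
  from LeastI_ex[OF this] obtain T :: "nat pair_pre_digraph" and X
    where "tree_decomposition G T X" "decomposition_width T X = treewidth G"
    unfolding treewidth_def by blast
  then show ?thesis using chi_ON_le_decomposition_width assms by metis
qed

section \<open>Vertex cover\<close>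

text \<open>Colours may be taken from any finite set; below, the vertices of a cover serve as their
  own colours.\<close>

lemma chi_ON_le_card_colours:
  assumes "finite S" and g: "\<And>v. v \<in> pverts G \<Longrightarrow> g v \<in> S"
    and wit: "\<And>v. v \<in> pverts G \<Longrightarrow> \<exists>u\<in>open_nbhd G v. \<forall>w\<in>open_nbhd G v - {u}. g u \<noteq> g w"
  shows "chi_ON G \<le> card S"
proof -
  obtain e :: "'b \<Rightarrow> nat" where e: "bij_betw e S {1..card S}"
    using assms(1) finite_same_card_bij[of S "{1..card S}"] by auto
  have "oncf_coloring G (card S) (\<lambda>v. e (g v))"
    unfolding oncf_coloring_def
  proof (intro conjI ballI)
    fix v assume v: "v \<in> pverts G"
    then show "e (g v) \<in> {1..card S}" using e g bij_betwE by blast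
    obtain u where u: "u \<in> open_nbhd G v" "\<forall>w\<in>open_nbhd G v - {u}. g u \<noteq> g w"
      using wit[OF v] by blast
    then have "\<forall>w\<in>open_nbhd G v - {u}. e (g u) \<noteq> e (g w)"
      using e g nbhd_verts by (metis DiffD1 bij_betw_imp_inj_on inj_on_contraD)
    then show "\<exists>u\<in>open_nbhd G v. \<forall>w\<in>open_nbhd G v - {u}. e (g u) \<noteq> e (g w)"
      using u(1) by blast
  qed
  then show ?thesis by (rule chi_ON_le)
qed

lemma vertex_coverD:
  assumes "vertex_cover G S" "u \<in> open_nbhd G v"
  shows "u \<in> S \<or> v \<in> S"
  using assms by (auto simp: vertex_cover_def open_nbhd_def)

lemma finite_vertex_cover: "vertex_cover G S \<Longrightarrow> finite S"
  using pair_finite_verts finite_subset unfolding vertex_cover_def by blast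

text \<open>A vertex outside \<open>S\<close> has all its neighbours in \<open>S\<close>, where the
  colours are pairwise distinct, so any neighbour is a witness. Only the vertices of
  \<open>S\<close> need attention.\<close>

lemma chi_ON_le_vertex_cover_retraction:
  assumes noniso: "\<forall>v\<in>pverts G. open_nbhd G v \<noteq> {}" and S: "vertex_cover G S"
    and g: "\<And>s. s \<in> S \<Longrightarrow> g s = s" "\<And>v. v \<in> pverts G - S \<Longrightarrow> g v \<in> S"
    and wit: "\<And>s. s \<in> S \<Longrightarrow> \<exists>u\<in>open_nbhd G s. \<forall>w\<in>open_nbhd G s - {u}. g u \<noteq> g w"
  shows "chi_ON G \<le> card S"
proof (rule chi_ON_le_card_colours)
  show "finite S" by (rule finite_vertex_cover[OF S])
  fix v assume v: "v \<in> pverts G"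
  then show "g v \<in> S" using g by (cases "v \<in> S") auto
  show "\<exists>u\<in>open_nbhd G v. \<forall>w\<in>open_nbhd G v - {u}. g u \<noteq> g w"
  proof (cases "v \<in> S")
    case False
    then have "open_nbhd G v \<subseteq> S" using vertex_coverD[OF S] by blast
    moreover obtain u where "u \<in> open_nbhd G v" using noniso v by blast
    ultimately show ?thesis using g(1) by (intro bexI[of _ u]) (auto simp: subset_iff)
  qed (use wit in blast)
qed

text \<open>With \<open>S\<close> first in the order, a vertex of \<open>S\<close> only has to avoid
  colours of other vertices of \<open>S\<close>, while an outer vertex has at most one colour to
  avoid per neighbour.\<close>

lemma chi_ON_le_if_vertex_cover_degrees:
  assumes noniso: "\<forall>v\<in>pverts G. open_nbhd G v \<noteq> {}" and S: "vertex_cover G S"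
    and q: "card S \<le> q" "\<And>x. x \<in> pverts G - S \<Longrightarrow> card (open_nbhd G x) < q"
  shows "chi_ON G \<le> q"
proof -
  have fin: "finite S" by (rule finite_vertex_cover[OF S])
  obtain r0 :: "'a \<Rightarrow> nat" where r0: "inj_on r0 (pverts G)" "\<And>v. v \<in> pverts G \<Longrightarrow> r0 v < card (pverts G)"
    using ex_vertex_numbering by blast
  define r where "r v = (if v \<in> S then r0 v else card (pverts G) + r0 v)" for v
  have "inj_on r (pverts G)"
  proof (rule inj_onI)
    fix u v assume uv: "u \<in> pverts G" "v \<in> pverts G" "r u = r v"
    then have "r0 u = r0 v" using r0(2)[of u] r0(2)[of v] by (auto simp: r_def split: if_splits)
    then show "u = v" using uv r0(1) by (auto simp: inj_on_def)
  qed
  then obtain f where f: "\<And>v. v \<in> pverts G \<Longrightarrow> f v \<in> open_nbhd G v"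
    and fr: "\<And>v u. v \<in> pverts G \<Longrightarrow> u \<in> open_nbhd G v \<Longrightarrow> u \<noteq> f v \<Longrightarrow> r (f v) < r u"
    using ex_earliest_neighbour noniso by metis
  have "card (f ` {v \<in> open_nbhd G w. f v \<noteq> w}) < q" if w: "w \<in> pverts G" for w
  proof (cases "w \<in> S")
    case True
    have "f ` {v \<in> open_nbhd G w. f v \<noteq> w} \<subseteq> S - {w}"
    proof clarify
      fix v assume v: "v \<in> open_nbhd G w" "f v \<noteq> w"
      have "r (f v) < r w" using fr v nbhd_verts nbhd_sym by metis
      then have "f v \<in> S" using True r0(2)[OF w] by (auto simp: r_def split: if_splits)
      then show "f v \<in> S - {w}" using v by blast
    qed
    then have "card (f ` {v \<in> open_nbhd G w. f v \<noteq> w}) \<le> card (S - {w})"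
      using fin by (intro card_mono) auto
    also have "\<dots> < card S" using True fin by (intro card_Diff1_less)
    finally show ?thesis using q(1) by simp
  next
    case False
    have "card (f ` {v \<in> open_nbhd G w. f v \<noteq> w}) \<le> card {v \<in> open_nbhd G w. f v \<noteq> w}"
      using finite_nbhd by (intro card_image_le) simp
    also have "\<dots> \<le> card (open_nbhd G w)" using finite_nbhd by (intro card_mono) auto
    finally show ?thesis using q(2) w False by fastforce
  qed
  then show ?thesis using chi_ON_le_if_few_earliest_neighbours[of f r] f fr by blast
qed

lemma chi_ON_le_vertex_cover_Suc:
  assumes noniso: "\<forall>v\<in>pverts G. open_nbhd G v \<noteq> {}" and S: "vertex_cover G S"
  shows "chi_ON G \<le> card S + 1"
proof (rule chi_ON_le_if_vertex_cover_degrees[OF noniso S])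
  fix x assume "x \<in> pverts G - S"
  then have "open_nbhd G x \<subseteq> S" using vertex_coverD[OF S] by blast
  moreover have "finite S" using finite_vertex_cover[OF S] .
  ultimately show "card (open_nbhd G x) < card S + 1" by (simp add: card_mono less_Suc_eq_le)
qed simp

lemma chi_ON_le_vertex_cover:
  assumes noniso: "\<forall>v\<in>pverts G. open_nbhd G v \<noteq> {}"
    and S: "vertex_cover G S" and min: "\<And>S'. vertex_cover G S' \<Longrightarrow> card S \<le> card S'"
    and not_star: "\<not> star_graph G" "\<not> edge_star_graph G"
  shows "chi_ON G \<le> card S"
proof (cases "\<exists>x0\<in>pverts G - S. open_nbhd G x0 = S")
  case False
  have fin: "finite S" by (rule finite_vertex_cover[OF S])
  show ?thesis
  proof (rule chi_ON_le_if_vertex_cover_degrees[OF noniso S order_refl])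
    fix x assume x: "x \<in> pverts G - S"
    then have "open_nbhd G x \<subset> S" using vertex_coverD[OF S] False by blast
    then show "card (open_nbhd G x) < card S" using fin psubset_card_mono by blast
  qed
next
  case True
  then obtain x0 where x0: "x0 \<in> pverts G" "x0 \<notin> S" "open_nbhd G x0 = S" by blast
  have sub: "S \<subseteq> pverts G" using S by (simp add: vertex_cover_def)
  have fin: "finite S" by (rule finite_vertex_cover[OF S])
  have x0N: "x0 \<in> open_nbhd G s" if "s \<in> S" for s using that x0(3) nbhd_sym by blast
  have outer: "open_nbhd G x \<subseteq> S" if "x \<notin> S" for x using that vertex_coverD[OF S] by blast
  have outer_ne: "open_nbhd G x \<noteq> {}" if "x \<in> pverts G" for x using that noniso by blast
  note retract = chi_ON_le_vertex_cover_retraction[OF noniso S]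
  obtain s0 where s0: "s0 \<in> S" using outer_ne[OF x0(1)] x0(3) by blast
  have not_single: "S \<noteq> {s}" for s
  proof
    assume eq: "S = {s}"
    have "open_nbhd G w = {s}" if "w \<in> pverts G - {s}" for w
      using that outer[of w] outer_ne[of w] unfolding eq by blast
    then show False using not_star(1) sub eq by (auto simp: star_graph_def)
  qed
  have other: "\<exists>q\<in>S. q \<noteq> s" for s using not_single[of s] s0 by (metis empty_iff insertI1 subsetI subset_singletonD)
  \<comment> \<open>When \<open>spare\<close> fails for \<open>t\<close>, some \<open>s\<close> has
    no neighbour in \<open>S\<close> other than \<open>t\<close>; when \<open>isolated\<close> fails
    too, it has exactly this one.\<close>
  consider (isolated) r where "r \<in> S" "open_nbhd G r \<inter> S = {}"
    | (spare) t where "t \<in> S" "\<And>s. s \<in> S \<Longrightarrow> \<exists>u\<in>open_nbhd G s \<inter> S. u \<noteq> t"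
    | (matching) "\<And>t. t \<in> S \<Longrightarrow> \<exists>s\<in>S. open_nbhd G s \<inter> S = {t}"
  proof (cases "\<exists>r\<in>S. open_nbhd G r \<inter> S = {}")
    case True
    then show ?thesis using isolated by blast
  next
    case ne: False
    show ?thesis
    proof (cases "\<exists>t\<in>S. \<forall>s\<in>S. \<exists>u\<in>open_nbhd G s \<inter> S. u \<noteq> t")
      case True
      then show ?thesis using spare by blast
    next
      case False
      have "\<exists>s\<in>S. open_nbhd G s \<inter> S = {t}" if t: "t \<in> S" for t
      proof -
        have "\<exists>s\<in>S. \<forall>u\<in>open_nbhd G s \<inter> S. u = t" using t False by auto
        then obtain s where s: "s \<in> S" "\<forall>u\<in>open_nbhd G s \<inter> S. u = t" by (elim bexE)
        moreover have "open_nbhd G s \<inter> S \<noteq> {}" using ne s(1) by auto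
        ultimately have "open_nbhd G s \<inter> S = {t}" by auto
        then show ?thesis using s(1) by (rule bexI)
      qed
      then show ?thesis by (rule matching)
    qed
  qed
  then show ?thesis
  proof cases
    \<comment> \<open>\<open>x0\<close> takes the colour of \<open>r\<close> and is the uniquely coloured neighbour of all of \<open>S\<close>.\<close>
    case isolated
    obtain q where q: "q \<in> S" "q \<noteq> r" using other by blast
    define g where "g v = (if v \<in> S then v else if v = x0 then r else q)" for v
    show ?thesis
    proof (rule retract[of g])
      fix s assume s: "s \<in> S"
      have "r \<notin> open_nbhd G s" using isolated s nbhd_sym by blast
      then have "\<forall>w\<in>open_nbhd G s - {x0}. g x0 \<noteq> g w" using x0(2) q(2) by (auto simp: g_def)
      then show "\<exists>u\<in>open_nbhd G s. \<forall>w\<in>open_nbhd G s - {u}. g u \<noteq> g w" using x0N[OF s] by blast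
    qed (use isolated q x0(2) in \<open>auto simp: g_def\<close>)
  next
    \<comment> \<open>With colour \<open>t\<close> on all outer vertices, a neighbour in
      \<open>S\<close> other than \<open>t\<close> is uniquely coloured.\<close>
    case spare
    define g where "g v = (if v \<in> S then v else t)" for v
    show ?thesis
    proof (rule retract[of g])
      fix s assume s: "s \<in> S"
      then obtain u where u: "u \<in> open_nbhd G s" "u \<in> S" "u \<noteq> t" using spare(2) by blast
      then have "\<forall>w\<in>open_nbhd G s - {u}. g u \<noteq> g w" by (auto simp: g_def)
      then show "\<exists>u\<in>open_nbhd G s. \<forall>w\<in>open_nbhd G s - {u}. g u \<noteq> g w" using u(1) by blast
    qed (use spare in \<open>auto simp: g_def\<close>)
  next
    \<comment> \<open>Here \<open>S\<close> induces a perfect matching.\<close>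
    case matching
    obtain p where p: "\<And>t. t \<in> S \<Longrightarrow> p t \<in> S" "\<And>t. t \<in> S \<Longrightarrow> open_nbhd G (p t) \<inter> S = {t}"
      using matching by metis
    \<comment> \<open>An injection of the finite set \<open>S\<close> into itself is onto, so every
      vertex of \<open>S\<close> is some \<open>p t\<close> and has exactly one neighbour in
      \<open>S\<close>.\<close>
    have "inj_on p S"
    proof (rule inj_onI)
      fix a b assume ab: "a \<in> S" "b \<in> S" "p a = p b"
      have "{a} = {b}" using p(2)[OF ab(1)] p(2)[OF ab(2)] unfolding ab(3) by (rule trans[OF sym])
      then show "a = b" by simp
    qed
    then have psurj: "p ` S = S" using fin p(1) by (intro endo_inj_surj) auto
    have partner: "\<exists>t\<in>S. open_nbhd G s \<inter> S = {t}" if s: "s \<in> S" for s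
    proof -
      have "s \<in> p ` S" using s psurj by simp
      then obtain t where "t \<in> S" "s = p t" by (elim imageE)
      then show ?thesis using p(2) by blast
    qed
    have unique: "a = b" if s: "s \<in> S" "a \<in> open_nbhd G s" "a \<in> S" "b \<in> open_nbhd G s" "b \<in> S" for a b s
    proof -
      obtain t where t: "open_nbhd G s \<inter> S = {t}" using partner[OF s(1)] by (elim bexE)
      have "a \<in> {t}" "b \<in> {t}" using that(2-5) unfolding t[symmetric] by simp_all
      then show ?thesis by simp
    qed
    obtain t0 where t0: "t0 \<in> S" "open_nbhd G s0 \<inter> S = {t0}" using partner[OF s0] by (elim bexE)
    have s0t0_nb: "t0 \<in> open_nbhd G s0" using t0(2) by (metis IntD1 insertI1)
    then have t0s0_nb: "s0 \<in> open_nbhd G t0" by (rule nbhd_sym)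
    have ne: "s0 \<noteq> t0" using s0t0_nb not_in_own_nbhd by metis
    show ?thesis
    proof (cases "S = {s0, t0}")
      case True
      have "(s0, t0) \<in> parcs G" using s0t0_nb by (simp add: open_nbhd_def)
      then obtain x1 where x1: "x1 \<in> pverts G" "x1 \<notin> S" "open_nbhd G x1 \<noteq> S"
        using not_star(2) unfolding True edge_star_graph_def by blast
      have sing: "\<exists>s t. S = {s, t} \<and> s \<noteq> t \<and> open_nbhd G x1 = {s} \<and> t \<in> open_nbhd G s"
      proof -
        have "open_nbhd G x1 = {s0} \<or> open_nbhd G x1 = {t0}"
          using outer[OF x1(2)] outer_ne[OF x1(1)] x1(3) unfolding True by blast
        then show ?thesis using True ne s0t0_nb t0s0_nb by (metis insert_commute)
      qed
      then obtain s t where st: "S = {s, t}" "s \<noteq> t" "open_nbhd G x1 = {s}" "t \<in> open_nbhd G s"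
        by blast
      \<comment> \<open>The pendant vertex \<open>x1\<close> exists because \<open>G\<close> is no
        edge-star. It is the witness for \<open>s\<close>. The vertex \<open>t\<close> does not see
        \<open>x1\<close>, so its neighbours other than \<open>s\<close> have colour
        \<open>t\<close>, and \<open>s\<close> is its witness.\<close>
      define g where "g v = (if v \<in> S then v else if v = x1 then s else t)" for v
      show ?thesis
      proof (rule retract[of g])
        fix z assume "z \<in> S"
        then consider "z = s" | "z = t" using st(1) by blast
        then show "\<exists>u\<in>open_nbhd G z. \<forall>w\<in>open_nbhd G z - {u}. g u \<noteq> g w"
        proof cases
          case 1
          have "x1 \<in> open_nbhd G s" using st(3) nbhd_sym by blast
          moreover have "\<forall>w\<in>open_nbhd G s - {x1}. g x1 \<noteq> g w"
            using x1(2) st(1,2) not_in_own_nbhd[of s] by (auto simp: g_def)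
          ultimately show ?thesis using 1 by blast
        next
          case 2
          have "s \<in> open_nbhd G t" using st(4) nbhd_sym by blast
          moreover have "x1 \<notin> open_nbhd G t" using st(2,3) nbhd_sym[of x1 t] by auto
          then have "\<forall>w\<in>open_nbhd G t - {s}. g s \<noteq> g w"
            using st(1,2) not_in_own_nbhd[of t] by (auto simp: g_def)
          ultimately show ?thesis using 2 by blast
        qed
      qed (use st in \<open>auto simp: g_def\<close>)
    next
      case False
      then obtain s2 where s2: "s2 \<in> S" "s2 \<noteq> s0" "s2 \<noteq> t0" using s0 t0(1) by blast
      show ?thesis
      proof (cases "\<exists>s\<in>S. \<exists>x1\<in>open_nbhd G s. x1 \<notin> S \<and> x1 \<noteq> x0")
        case True
        then obtain s x1 where s: "s \<in> S" and x1: "x1 \<in> open_nbhd G s" "x1 \<notin> S" "x1 \<noteq> x0" by blast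
        obtain t where t: "t \<in> S" "open_nbhd G s \<inter> S = {t}" using partner[OF s] by (elim bexE)
        have ts: "t \<in> open_nbhd G s" using t(2) by (metis IntD1 insertI1)
        have only_t: "w = t" if "w \<in> open_nbhd G s" "w \<in> S" for w
          using unique[OF s that ts t(1)] .
        obtain u where u: "u \<in> S" "u \<noteq> t" using other by blast
        obtain y where y: "y \<in> S" "y \<noteq> t" "y \<noteq> u" using s2 s0 t0(1) ne by metis
        \<comment> \<open>The colours \<open>t\<close>, \<open>u\<close>, \<open>y\<close> are
          distinct and \<open>t\<close> is the partner of \<open>s\<close>. So \<open>x1\<close> is
          the witness for \<open>s\<close>, whose other neighbours have colours \<open>t\<close> and
          \<open>y\<close>; every other \<open>z\<close> in \<open>S\<close> does not see
          \<open>t\<close>, and \<open>x0\<close> is its witness.\<close>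
        define g where "g v = (if v \<in> S then v else if v = x0 then t else if v = x1 then u else y)" for v
        show ?thesis
        proof (rule retract[of g])
          fix z assume z: "z \<in> S"
          show "\<exists>u\<in>open_nbhd G z. \<forall>w\<in>open_nbhd G z - {u}. g u \<noteq> g w"
          proof (cases "z = s")
            case True
            have "\<forall>w\<in>open_nbhd G s - {x1}. g x1 \<noteq> g w"
              using x1 only_t u y by (auto simp: g_def)
            then show ?thesis using True x1(1) by blast
          next
            case False
            have "t \<notin> open_nbhd G z"
            proof
              assume "t \<in> open_nbhd G z"
              then have "z = s" using unique[OF t(1) nbhd_sym z nbhd_sym s] ts by blast
              then show False using False by simp
            qed
            then have "\<forall>w\<in>open_nbhd G z - {x0}. g x0 \<noteq> g w"
              using x0(2) u y by (auto simp: g_def)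
            then show ?thesis using x0N[OF z] by blast
          qed
        qed (use t u y in \<open>auto simp: g_def\<close>)
      next
        \<comment> \<open>\<open>G\<close> is a windmill of at least two triangles around \<open>x0\<close>, so \<open>S\<close> is not minimum.\<close>
        case no_x1: False
        \<comment> \<open>The vertices \<open>s0\<close> and \<open>s2\<close> come from different
          pairs. Their neighbours are their partners and \<open>x0\<close>, so exchanging both for
          \<open>x0\<close> keeps a cover and saves one vertex.\<close>
        let ?S' = "insert x0 (S - {s0, s2})"
        have s2_nb: "s0 \<notin> open_nbhd G s2" "s2 \<notin> open_nbhd G s0"
          using unique[OF s0 _ s2(1) s0t0_nb t0(1)] s2(3) nbhd_sym by blast+
        have covered: "b \<in> ?S'" if "a \<in> S" "a \<notin> ?S'" "b \<in> open_nbhd G a" for a b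
        proof -
          have "a = s0 \<or> a = s2" using that by blast
          moreover have "b \<in> S \<or> b = x0" using no_x1 that by auto
          ultimately show ?thesis using that(3) s2_nb not_in_own_nbhd by blast
        qed
        have "vertex_cover G ?S'"
          unfolding vertex_cover_def
        proof (intro conjI ballI, goal_cases)
          case 1
          then show ?case using sub x0(1) by blast
        next
          case (2 e)
          obtain a b where e: "e = (a, b)" by (cases e)
          then have ab: "b \<in> open_nbhd G a" using 2 by (simp add: open_nbhd_def)
          have "a \<in> ?S' \<or> b \<in> ?S'"
            using vertex_coverD[OF S ab] covered[of a b] covered[of b a] ab nbhd_sym by blast
          then show ?case using e by simp
        qed
        then have "card S \<le> card ?S'" by (rule min)
        also have "\<dots> = Suc (card (S - {s0, s2}))" using x0(2) fin by simp
        also have "\<dots> = Suc (card S - 2)" using s0 s2 fin by (simp add: card_Diff_subset)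
        finally have "card S \<le> 1" by simp
        moreover have "card {s0, s2} \<le> card S" using s0 s2 fin by (intro card_mono) auto
        ultimately show ?thesis using s2(2) by simp
      qed
    qed
  qed
qed

lemma ex_minimum_vertex_cover:
  "\<exists>S. vertex_cover G S \<and> card S = vc G \<and> (\<forall>S'. vertex_cover G S' \<longrightarrow> card S \<le> card S')"
proof -
  have "\<exists>k S. vertex_cover G S \<and> card S = k" using vertex_cover_verts[OF pair_graph_axioms] by blast
  from LeastI_ex[OF this] obtain S where S: "vertex_cover G S" "card S = vc G"
    unfolding vc_def by blast
  moreover have "vc G \<le> card S'" if "vertex_cover G S'" for S'
    unfolding vc_def using that by (intro Least_le) blast
  ultimately show ?thesis by (intro exI[of _ S]) simp
qed

section \<open>Feedback vertex set\<close>

text \<open>The witness of a vertex \<open>s\<close> of \<open>S\<close> is the leaf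
  \<open>L s\<close> if \<open>s\<close> is in \<open>S3\<close>, and \<open>f s\<close> otherwise.
  The witness of a forest vertex is a leaf of colour \<open>a\<close> below it, else a neighbour in
  \<open>S\<close> coloured unlike the parent, else the parent or the first child.\<close>

lemma chi_ON_le_feedback_vertex_set:
  assumes noniso: "\<forall>v\<in>pverts G. open_nbhd G v \<noteq> {}" and S: "feedback_vertex_set G S"
  shows "chi_ON G \<le> card S + 3"
proof -
  let ?N = "open_nbhd G"
  define F where "F = pverts G - S"
  have sub: "S \<subseteq> pverts G" and forest: "undirected_forest (with_proj G \<restriction> F)"
    using S by (auto simp: feedback_vertex_set_def F_def)
  have fin: "finite S" using sub pair_finite_verts by (rule finite_subset)
  have V: "v \<in> S \<or> v \<in> F" if "v \<in> pverts G" for v using that by (simp add: F_def)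
  have SF: "v \<notin> F" if "v \<in> S" for v using that by (simp add: F_def)
  obtain idx :: "'a \<Rightarrow> nat" where inj: "inj_on idx F"
    and parent: "\<And>v a b. v \<in> F \<Longrightarrow> a \<in> F \<Longrightarrow> b \<in> F \<Longrightarrow> a \<in> ?N v \<Longrightarrow> b \<in> ?N v \<Longrightarrow>
           idx a < idx v \<Longrightarrow> idx b < idx v \<Longrightarrow> a = b"
  proof (rule forest_numbering[of "with_proj G \<restriction> F"])
    show "finite (verts (with_proj G \<restriction> F))" using pair_finite_verts by (simp add: F_def)
    show "sym (arcs (with_proj G \<restriction> F))"
      using pair_sym_arcs by (auto simp: symmetric_def sym_def)
    show "irrefl (arcs (with_proj G \<restriction> F))"
      using not_in_own_nbhd by (auto simp: irrefl_def open_nbhd_def)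
    fix j :: "'a \<Rightarrow> nat"
    assume j: "inj_on j (verts (with_proj G \<restriction> F))"
      and p: "\<And>v a b. v \<in> verts (with_proj G \<restriction> F) \<Longrightarrow> a \<in> verts (with_proj G \<restriction> F) \<Longrightarrow>
        b \<in> verts (with_proj G \<restriction> F) \<Longrightarrow> (v, a) \<in> arcs (with_proj G \<restriction> F) \<Longrightarrow>
        (v, b) \<in> arcs (with_proj G \<restriction> F) \<Longrightarrow> j a < j v \<Longrightarrow> j b < j v \<Longrightarrow> a = b"
    show thesis
    proof (rule that[of j])
      show "inj_on j F" using j by simp
      show "a = b" if "v \<in> F" "a \<in> F" "b \<in> F" "a \<in> ?N v" "b \<in> ?N v" "j a < j v" "j b < j v" for v a b
        using p[of v a b] that by (simp add: open_nbhd_def)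
    qed
  qed (use forest in simp_all)

  \<comment> \<open>The parent as a set with at most one element, so that roots need no separate
    treatment.\<close>
  define Pa where "Pa x = {p. x \<in> F \<and> p \<in> F \<and> p \<in> ?N x \<and> idx p < idx x}" for x
  have Pa_unique: "p = p'" if "p \<in> Pa x" "p' \<in> Pa x" for p p' x
    using that parent by (auto simp: Pa_def)
  have Pa_le1: "Pa x = {} \<or> (\<exists>p. Pa x = {p})" for x using Pa_unique by blast
  have nb_cases: "w \<in> S \<or> w \<in> Pa p \<or> p \<in> Pa w" if "p \<in> F" "w \<in> ?N p" for p w
  proof (cases "w \<in> S")
    case False
    then have "w \<in> F" using nbhd_verts[OF that(2)] by (simp add: F_def)
    moreover have "idx w \<noteq> idx p"
      using inj_onD[OF inj, of w p] \<open>w \<in> F\<close> that not_in_own_nbhd[of p] by metis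
    ultimately show ?thesis using that nbhd_sym[OF that(2)] by (auto simp: Pa_def)
  qed simp

  \<comment> \<open>The only vertices that can get stuck below: leaves of the forest whose remaining neighbour is a
    single \<open>s \<in> S\<close>. One such leaf \<open>L s\<close> serves as the uniquely coloured neighbour of \<open>s\<close>.\<close>
  define S3 where "S3 = {s \<in> S. \<exists>v w. v \<in> F \<and> w \<in> F \<and> ?N v = {w, s} \<and> idx w < idx v}"
  have S3S: "s \<in> S" if "s \<in> S3" for s using that by (simp add: S3_def)
  have "\<forall>s. \<exists>v w. s \<in> S3 \<longrightarrow> v \<in> F \<and> w \<in> F \<and> ?N v = {w, s} \<and> idx w < idx v"
    by (auto simp: S3_def)
  then obtain L W where LW: "\<And>s. s \<in> S3 \<Longrightarrow> L s \<in> F \<and> W s \<in> F \<and> ?N (L s) = {W s, s} \<and> idx (W s) < idx (L s)"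
    by metis
  have LF: "L s \<in> F" and WF: "W s \<in> F" and NL: "?N (L s) = {W s, s}" and WL: "idx (W s) < idx (L s)"
    if "s \<in> S3" for s using LW[OF that] by auto
  have L_nb: "s = s'" if "s \<in> S3" "s' \<in> S" "s' \<in> ?N (L s)" for s s'
    using NL[OF that(1)] WF[OF that(1)] SF[OF that(2)] that(3) by auto
  have L_inj: "inj_on L S3"
  proof (rule inj_onI)
    fix s s' assume "s \<in> S3" "s' \<in> S3" "L s = L s'"
    then show "s = s'" using L_nb[of s s'] S3S[of s'] NL[of s'] by auto
  qed
  have L_Pa: "p = W s" if "s \<in> S3" "p \<in> Pa (L s)" for s p
    using that NL[of s] SF[OF S3S, of s] by (auto simp: Pa_def)
  \<comment> \<open>These leaves have no children; hence every parent lies in \<open>A\<close>, the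
    part that is coloured greedily.\<close>
  have L_not_Pa: "L s \<notin> Pa p" if "s \<in> S3" for s p
  proof
    assume *: "L s \<in> Pa p"
    then have "p \<in> ?N (L s)" "p \<in> F" "idx (L s) < idx p" using nbhd_sym by (auto simp: Pa_def)
    then show False using NL[OF that] SF[OF S3S[OF that]] WL[OF that] by auto
  qed
  define V3 where "V3 = L ` S3"
  define A where "A = F - V3"
  have PaA: "u \<in> A" if "u \<in> Pa p" for u p
  proof -
    have "u \<notin> V3" using that L_not_Pa unfolding V3_def by (metis imageE)
    then show ?thesis using that by (simp add: A_def Pa_def)
  qed

  \<comment> \<open>\<open>P w\<close> collects the \<open>s\<close> whose leaf hangs below
    \<open>w\<close>. The leaf of the chosen \<open>m w\<close> will get the reserved colour and be
    the witness for \<open>w\<close>.\<close>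
  define P where "P w = {s \<in> S3. W s = w}" for w
  define m where "m w = (SOME s. s \<in> P w)" for w
  have m: "m w \<in> P w" if "P w \<noteq> {}" for w using that by (simp add: m_def some_in_eq)
  have childA: "w \<in> A" if "p \<in> Pa w" "P p = {}" for w p
  proof -
    have "w \<noteq> L s" if "s \<in> S3" for s
    proof
      assume "w = L s"
      then have "s \<in> P p" using L_Pa[OF that, of p] \<open>p \<in> Pa w\<close> that by (simp add: P_def)
      then show False using \<open>P p = {}\<close> by simp
    qed
    then have "w \<notin> V3" by (auto simp: V3_def)
    then show ?thesis using that(1) by (simp add: A_def Pa_def)
  qed

  define k where "k = card S"
  have "\<exists>col. bij_betw col S {1..k}"
    by (rule finite_same_card_bij) (use fin in \<open>simp_all add: k_def\<close>)
  then obtain col where col: "bij_betw col S {1..k}" by (elim exE)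
  have col_range: "1 \<le> col s \<and> col s \<le> k" if "s \<in> S" for s using bij_betwE[OF col] that by auto
  have col_inj: "s = s'" if "s \<in> S" "s' \<in> S" "col s = col s'" for s s'
    by (rule inj_onD[OF bij_betw_imp_inj_on[OF col] that(3,1,2)])
  \<comment> \<open>The reserved colour: \<open>col\<close> does not take it and the greedy step
    forbids it.\<close>
  define a where "a = k + 1"
  have col_a: "col s \<noteq> a" if "s \<in> S" for s using col_range[OF that] by (simp add: a_def)

  have "\<exists>u. u \<in> ?N s \<and> (u \<in> S \<or> ?N s \<inter> S = {} \<and> (\<forall>x\<in>?N s. x \<noteq> u \<longrightarrow> idx u < idx x))"
    if s: "s \<in> S" for s
  proof (cases "?N s \<inter> S = {}")
    case True
    then have NF: "?N s \<subseteq> F" using nbhd_verts V by blast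
    let ?u = "arg_min_on idx (?N s)"
    have ne: "?N s \<noteq> {}" using noniso sub s by blast
    have u: "?u \<in> ?N s" "\<And>x. x \<in> ?N s \<Longrightarrow> idx ?u \<le> idx x"
      using arg_min_if_finite[OF finite_nbhd ne, of idx] by (auto simp: not_less)
    have "idx ?u < idx x" if "x \<in> ?N s" "x \<noteq> ?u" for x
    proof -
      have "idx ?u \<noteq> idx x" using inj_onD[OF inj, of ?u x] NF u(1) that by blast
      then show ?thesis using u(2)[OF that(1)] by simp
    qed
    then show ?thesis using True u(1) by blast
  qed blast
  \<comment> \<open>For \<open>s\<close> outside \<open>S3\<close> the witness \<open>f s\<close> is
    a neighbour in \<open>S\<close>, whose colour is fixed, or else the earliest neighbour in the
    forest.\<close>
  then obtain f where f: "\<And>s. s \<in> S \<Longrightarrow> f s \<in> ?N s"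
    and f_first: "\<And>s. s \<in> S \<Longrightarrow> f s \<in> S \<or> ?N s \<inter> S = {} \<and> (\<forall>x\<in>?N s. x \<noteq> f s \<longrightarrow> idx (f s) < idx x)"
    by metis

  define y where "y p = arg_min_on idx {x. p \<in> Pa x}" for p
  have finPa: "finite {x. p \<in> Pa x}" for p
    using pair_finite_verts by (rule finite_subset[rotated]) (auto simp: Pa_def F_def)
  have y: "p \<in> Pa (y p)" "idx (y p) \<le> idx x" if "p \<in> Pa x" for p x
    using arg_min_if_finite[OF finPa, of p idx] that unfolding y_def by (auto simp: not_less)
  have y_less: "idx (y p) < idx x" if "p \<in> Pa x" "x \<noteq> y p" for p x
  proof -
    have "x \<in> F" "y p \<in> F" using that(1) y(1)[OF that(1)] by (auto simp: Pa_def)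
    then have "idx (y p) \<noteq> idx x" using inj_onD[OF inj, of "y p" x] that(2) by blast
    then show ?thesis using y(2)[OF that(1)] by simp
  qed

  \<comment> \<open>\<open>Y c p x\<close> is what a child \<open>x\<close> of \<open>p\<close> avoids for the sake of \<open>p\<close>: the colour of a neighbour in
    \<open>S\<close> whose colour differs from that of the parent of \<open>p\<close>, else of the parent, else of the first
    child \<open>y p\<close>. Nothing is needed if \<open>p\<close> has a child \<open>L s\<close>, since exactly one of these has colour
    \<open>a\<close>.\<close>
  define good where "good c p s \<longleftrightarrow> s \<in> ?N p \<and> s \<in> S \<and> col s \<notin> c ` Pa p" for c p s
  define Y where "Y c p x =
      (if P p \<noteq> {} then {}
       else if \<exists>s. good c p s then {col (SOME s. good c p s)}
       else if ?N p \<inter> S = {} \<and> Pa p \<noteq> {} \<or> x = y p then c ` Pa p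
       else {c (y p)})" for c p x
  define Forb where "Forb c x =
      insert a (col ` S3 \<union> c ` f ` {s \<in> S - S3. s \<in> ?N x \<and> f s \<noteq> x} \<union> (\<Union>p\<in>Pa x. Y c p x))" for c x

  \<comment> \<open>Each \<open>s \<in> S\<close> forbids one colour only: its own if \<open>s \<in> S3\<close>, that of \<open>f s\<close> otherwise.\<close>
  have Y_card: "finite (Y c p x) \<and> card (Y c p x) \<le> 1" for c p x
    using Pa_le1[of p] by (auto simp: Y_def)
  have card_Forb: "finite (Forb c x) \<and> card (Forb c x) < k + 3" for c x
  proof -
    let ?Z = "\<Union>p\<in>Pa x. Y c p x"
    let ?B = "{s \<in> S - S3. s \<in> ?N x \<and> f s \<noteq> x}"
    have Z: "finite ?Z" "card ?Z \<le> 1" using Pa_le1[of x] Y_card by auto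
    have fin3: "finite S3" using fin by (rule finite_subset[rotated]) (auto simp: S3_def)
    have "card (c ` f ` ?B) \<le> card ?B"
      using fin by (metis (no_types, lifting) card_image_le finite_Diff finite_imageI finite_subset le_trans mem_Collect_eq subsetI)
    also have "\<dots> \<le> card (S - S3)" using fin by (intro card_mono) auto
    finally have B: "card (c ` f ` ?B) \<le> card (S - S3)" .
    have "card (col ` S3 \<union> c ` f ` ?B \<union> ?Z) \<le> card (col ` S3) + card (c ` f ` ?B) + card ?Z"
      by (meson add_le_mono1 card_Un_le le_trans)
    also have "\<dots> \<le> card S3 + card (S - S3) + 1"
      using Z(2) B card_image_le[OF fin3, of col] by linarith
    also have "card S3 + card (S - S3) = k"
    proof -
      have "S3 \<subseteq> S" using S3S by blast
      then show ?thesis using card_Diff_subset[OF fin3] card_mono[OF fin] by (simp add: k_def)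
    qed
    finally have "card (col ` S3 \<union> c ` f ` ?B \<union> ?Z) \<le> k + 1" .
    moreover have "finite (col ` S3 \<union> c ` f ` ?B \<union> ?Z)" using fin fin3 Z(1) by auto
    ultimately show ?thesis
      unfolding Forb_def by (auto simp: card_insert_if)
  qed
  \<comment> \<open>The vertices whose colours enter \<open>Forb c x\<close> are precoloured or
    precede \<open>x\<close>: \<open>f s\<close> is in \<open>S\<close> or precedes the other
    neighbours of \<open>s\<close>, a grandparent has a smaller number, and the first child
    \<open>y p\<close> precedes its siblings.\<close>
  have local: "Forb c x = Forb c' x"
    if x: "x \<in> A" and eq: "\<And>z. z \<notin> A \<or> idx z < idx x \<Longrightarrow> c z = c' z" for c c' x
  proof -
    have 1: "c (f s) = c' (f s)" if "s \<in> S" "s \<in> ?N x" "f s \<noteq> x" for s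
    proof (rule eq)
      show "f s \<notin> A \<or> idx (f s) < idx x"
        using f_first[OF that(1)] nbhd_sym[OF that(2)] that(3) SF by (auto simp: A_def)
    qed
    have 2: "Y c p x = Y c' p x" if p: "p \<in> Pa x" for p
    proof -
      have "c u = c' u" if "u \<in> Pa p" for u using that p by (intro eq) (auto simp: Pa_def)
      then have im: "c ` Pa p = c' ` Pa p" by (rule image_cong[OF refl])
      then have gd: "good c p = good c' p" by (simp add: good_def fun_eq_iff)
      show ?thesis
      proof (cases "x = y p")
        case True
        then show ?thesis unfolding Y_def im gd by auto
      next
        case False
        then have "c (y p) = c' (y p)" using y_less[OF p] by (intro eq) simp
        then show ?thesis unfolding Y_def im gd by (simp only:)
      qed
    qed
    have "c ` f ` {s \<in> S - S3. s \<in> ?N x \<and> f s \<noteq> x} = c' ` f ` {s \<in> S - S3. s \<in> ?N x \<and> f s \<noteq> x}"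
      using 1 by (intro image_cong[OF refl]) auto
    then show ?thesis unfolding Forb_def using 2 by simp
  qed

  \<comment> \<open>A leaf that does not get \<open>a\<close> repeats the colour of its
    \<open>s\<close>. No other neighbour of \<open>s\<close> has that colour, since the greedy step
    avoids the colours of \<open>S3\<close>.\<close>
  define R where "R s = (if s = m (W s) then a else col s)" for s
  define pre where "pre v = (if v \<in> S then col v else R (inv_into S3 L v))" for v
  have "\<exists>c. (\<forall>z. z \<notin> A \<longrightarrow> c z = pre z) \<and> (\<forall>x\<in>A. c x \<in> {1..k + 3} - Forb c x)"
    using local card_Forb by (rule greedy_coloring[where r = idx])
  then obtain c where c_pre: "\<forall>z. z \<notin> A \<longrightarrow> c z = pre z"
    and c_A: "\<forall>x\<in>A. c x \<in> {1..k + 3} - Forb c x" by (elim exE conjE)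
  have cS: "c s = col s" if "s \<in> S" for s
    using c_pre that SF[OF that] by (simp add: A_def pre_def)
  have cL: "c (L s) = R s" if "s \<in> S3" for s
  proof -
    have "L s \<notin> A" "L s \<notin> S" using that LF[OF that] SF by (auto simp: A_def V3_def)
    then show ?thesis using c_pre inv_into_f_f[OF L_inj that] by (simp add: pre_def)
  qed
  have cA_range: "c x \<in> {1..k + 3}" and cA_a: "c x \<noteq> a" and cA_S3: "c x \<notin> col ` S3"
    and cA_f: "\<And>s. s \<in> S - S3 \<Longrightarrow> s \<in> ?N x \<Longrightarrow> f s \<noteq> x \<Longrightarrow> c x \<noteq> c (f s)"
    and cA_Y: "\<And>p. p \<in> Pa x \<Longrightarrow> c x \<notin> Y c p x" if "x \<in> A" for x
  proof -
    have *: "c x \<in> {1..k + 3}" "c x \<notin> Forb c x" using c_A that by auto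
    show "c x \<in> {1..k + 3}" by (rule *)
    show "c x \<noteq> a" "c x \<notin> col ` S3" using *(2) unfolding Forb_def by auto
    show "c x \<noteq> c (f s)" if "s \<in> S - S3" "s \<in> ?N x" "f s \<noteq> x" for s
    proof
      assume "c x = c (f s)"
      then have "c x \<in> c ` f ` {s \<in> S - S3. s \<in> ?N x \<and> f s \<noteq> x}" using that by auto
      then show False using *(2) unfolding Forb_def by auto
    qed
    show "c x \<notin> Y c p x" if "p \<in> Pa x" for p using *(2) that unfolding Forb_def by auto
  qed

  have "oncf_coloring G (k + 3) c" unfolding oncf_coloring_def
  proof (intro conjI ballI)
    fix v assume v: "v \<in> pverts G"
    show "c v \<in> {1..k + 3}"
    proof -
      consider "v \<in> S" | s where "s \<in> S3" "v = L s" | "v \<in> A" using V[OF v] by (auto simp: A_def V3_def)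
      then show ?thesis
      proof cases
        case 1
        then show ?thesis using cS col_range by fastforce
      next
        case 2
        then show ?thesis using cL[of s] col_range[OF S3S, of s] by (auto simp: R_def a_def)
      next
        case 3
        then show ?thesis by (rule cA_range)
      qed
    qed
    show "\<exists>u\<in>?N v. \<forall>w\<in>?N v - {u}. c u \<noteq> c w"
    proof (cases "v \<in> S")
      case vS: True
      show ?thesis
      proof (cases "v \<in> S3")
        case True
        have Lv: "L v \<in> ?N v" using NL[OF True] nbhd_sym[of v "L v"] by simp
        have "c (L v) \<noteq> c w" if w: "w \<in> ?N v" "w \<noteq> L v" for w
        proof -
          have cLv: "c (L v) \<in> {a, col v}" using cL[OF True] by (simp add: R_def)
          consider "w \<in> S" | s where "s \<in> S3" "w = L s" | "w \<in> A"
            using V[OF nbhd_verts[OF w(1)]] by (auto simp: A_def V3_def)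
          then show ?thesis
          proof cases
            case 1
            have "w \<noteq> v" using w(1) not_in_own_nbhd by metis
            then have "col w \<noteq> col v" using col_inj 1 vS by metis
            then show ?thesis using cLv cS[OF 1] col_a[OF 1] by auto
          next
            case 2
            then have "s = v" using L_nb[of s v] vS nbhd_sym[OF w(1)] by simp
            then show ?thesis using 2 w(2) by simp
          next
            case 3
            have "c w \<noteq> col v" using cA_S3[OF 3] imageI[OF True, of col] by auto
            then show ?thesis using cLv cA_a[OF 3] by auto
          qed
        qed
        then show ?thesis using Lv by (intro bexI[of _ "L v"]) auto
      next
        case vS3: False
        have "c (f v) \<noteq> c w" if w: "w \<in> ?N v" "w \<noteq> f v" for w
        proof -
          consider "w \<in> S" | s where "s \<in> S3" "w = L s" | "w \<in> A"
            using V[OF nbhd_verts[OF w(1)]] by (auto simp: A_def V3_def)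
          then show ?thesis
          proof cases
            case 1
            then have "f v \<in> S" using f_first[OF vS] w(1) by auto
            then show ?thesis using cS 1 col_inj w(2) by metis
          next
            case 2
            then have "s = v" using L_nb[of s v] vS nbhd_sym[OF w(1)] by simp
            then show ?thesis using 2 vS3 by simp
          next
            case 3
            then show ?thesis using cA_f[OF 3, of v] vS vS3 nbhd_sym[OF w(1)] w(2) by auto
          qed
        qed
        then show ?thesis using f[OF vS] by (intro bexI[of _ "f v"]) auto
      qed
    next
      case False
      then have vF: "v \<in> F" using V[OF v] by simp
      show ?thesis
      proof (cases "P v = {}")
        case vP: False
        then have m3: "m v \<in> S3" "W (m v) = v" using m[of v] by (auto simp: P_def)
        let ?u = "L (m v)"
        have u: "?u \<in> ?N v" using NL[OF m3(1)] m3(2) nbhd_sym[of v ?u] by simp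
        have cu: "c ?u = a" using cL[OF m3(1)] m3(2) by (simp add: R_def)
        have "a \<noteq> c w" if w: "w \<in> ?N v" "w \<noteq> ?u" for w
        proof -
          consider "w \<in> S" | s where "s \<in> S3" "w = L s" | "w \<in> A"
            using V[OF nbhd_verts[OF w(1)]] by (auto simp: A_def V3_def)
          then show ?thesis
          proof cases
            case 1
            then show ?thesis using cS[OF 1] col_a[OF 1] by simp
          next
            case 2
            then have "v \<in> {W s, s}" using NL[of s] nbhd_sym[OF w(1)] by simp
            then have "W s = v" using SF[OF S3S[OF 2(1)]] vF by auto
            then have "s \<noteq> m (W s)" using 2(2) w(2) by auto
            then show ?thesis using cL[OF 2(1)] 2 col_a[OF S3S[OF 2(1)]] by (simp add: R_def)
          next
            case 3
            then show ?thesis using cA_a[OF 3] by simp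
          qed
        qed
        then show ?thesis using u cu by (intro bexI[of _ ?u]) auto
      next
        case vP: True
        have child: "w \<in> A" "c w \<notin> Y c v w" if "v \<in> Pa w" for w
          using childA[OF that vP] cA_Y[OF _ that] by auto
        show ?thesis
        proof (cases "\<exists>s. good c v s")
          case True
          define s where "s = (SOME s. good c v s)"
          have "good c v s" unfolding s_def using True by (rule someI_ex)
          then have s: "s \<in> ?N v" "s \<in> S" "col s \<notin> c ` Pa v" by (auto simp: good_def)
          have "c s \<noteq> c w" if w: "w \<in> ?N v" "w \<noteq> s" for w
            using nb_cases[OF vF w(1)]
          proof (elim disjE)
            assume "w \<in> S"
            then show ?thesis using cS s(2) col_inj w(2) by metis
          next
            assume "w \<in> Pa v"
            then show ?thesis using s(3) cS[OF s(2)] by auto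
          next
            assume "v \<in> Pa w"
            from child(2)[OF this] show ?thesis using vP True cS[OF s(2)] by (auto simp: Y_def s_def)
          qed
          then show ?thesis using s(1) by (intro bexI[of _ s]) auto
        next
          case no_good: False
          show ?thesis
          proof (cases "?N v \<inter> S = {} \<and> Pa v \<noteq> {}")
            case True
            then obtain u where u: "u \<in> Pa v" by blast
            have "c u \<noteq> c w" if w: "w \<in> ?N v" "w \<noteq> u" for w
              using nb_cases[OF vF w(1)]
            proof (elim disjE)
              assume "w \<in> S"
              then show ?thesis using True w(1) by blast
            next
              assume "w \<in> Pa v"
              then show ?thesis using Pa_unique u w(2) by metis
            next
              assume "v \<in> Pa w"
              from child(2)[OF this] have "c w \<notin> c ` Pa v" using vP no_good True by (simp add: Y_def)
              then show ?thesis using imageI[OF u, of c] by auto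
            qed
            moreover have "u \<in> ?N v" using u by (simp add: Pa_def)
            ultimately show ?thesis by (intro bexI[of _ u]) auto
          next
            case bad: False
            have S_nb: "c s \<in> c ` Pa v" if "s \<in> ?N v" "s \<in> S" for s
              using no_good that cS[OF that(2)] by (auto simp: good_def)
            \<comment> \<open>Without a child, \<open>v\<close> would have only its parent
              \<open>u\<close> and one \<open>s\<close> of the same colour as neighbours. Then
              \<open>s\<close> is in \<open>S3\<close>, but \<open>u\<close>, as a vertex of
              \<open>A\<close>, avoids the colours of \<open>S3\<close>.\<close>
            have ex_child: "\<exists>x. v \<in> Pa x"
            proof (rule ccontr)
              assume no_child: "\<nexists>x. v \<in> Pa x"
              have nb: "w \<in> S \<or> w \<in> Pa v" if "w \<in> ?N v" for w
                using nb_cases[OF vF that] no_child by blast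
              obtain w where w: "w \<in> ?N v" using noniso v by blast
              have "?N v \<inter> S \<noteq> {}"
              proof
                assume e: "?N v \<inter> S = {}"
                then have "Pa v \<noteq> {}" using nb[OF w] w by blast
                then show False using bad e by simp
              qed
              then obtain s where s: "s \<in> ?N v" "s \<in> S" by blast
              then obtain u where u: "u \<in> Pa v" "c s = c u" using S_nb by blast
              have "z = u \<or> z = s" if z: "z \<in> ?N v" for z
                using nb[OF z]
              proof
                assume zS: "z \<in> S"
                then obtain u' where "u' \<in> Pa v" "c z = c u'" using S_nb[OF z] by blast
                then have "col z = col s" using Pa_unique[OF u(1)] u(2) cS zS s(2) by metis
                then show ?thesis using col_inj zS s(2) by metis
              next
                assume "z \<in> Pa v"
                then show ?thesis using Pa_unique u(1) by metis
              qed
              then have "?N v = {u, s}" using s(1) u(1) by (auto simp: Pa_def)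
              then have "s \<in> S3" using s(2) u(1) unfolding S3_def Pa_def by blast
              then show False using cA_S3[OF PaA[OF u(1)]] u(2) cS[OF s(2)] by (metis imageI)
            qed
            then have y_child: "v \<in> Pa (y v)" using y(1) by blast
            \<comment> \<open>The first child is the witness: neighbours in \<open>S\<close> carry
              the colour of the parent, which \<open>y v\<close> avoids, and the later children
              avoid the colour of \<open>y v\<close>.\<close>
            have cy: "c (y v) \<notin> c ` Pa v" using child(2)[OF y_child] vP no_good by (simp add: Y_def)
            have "c (y v) \<noteq> c w" if w: "w \<in> ?N v" "w \<noteq> y v" for w
              using nb_cases[OF vF w(1)]
            proof (elim disjE)
              assume "w \<in> S"
              then show ?thesis using S_nb[OF w(1)] cy by metis
            next
              assume "w \<in> Pa v"
              then show ?thesis using cy by (metis imageI)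
            next
              assume "v \<in> Pa w"
              from child(2)[OF this] show ?thesis using vP no_good bad w(2) by (auto simp: Y_def)
            qed
            moreover have "y v \<in> ?N v" using y_child nbhd_sym by (auto simp: Pa_def)
            ultimately show ?thesis by (intro bexI[of _ "y v"]) auto
          qed
        qed
      qed
    qed
  qed
  then show ?thesis using chi_ON_le by (simp add: k_def)
qed

lemma chi_ON_le_fvs:
  assumes "\<forall>v\<in>pverts G. open_nbhd G v \<noteq> {}"
  shows "chi_ON G \<le> fvs G + 3"
proof -
  have "\<exists>k S. feedback_vertex_set G S \<and> card S = k" using feedback_vertex_set_verts by blast
  from LeastI_ex[OF this] obtain S where "feedback_vertex_set G S" "card S = fvs G"
    unfolding fvs_def by blast
  then show ?thesis using chi_ON_le_feedback_vertex_set[OF assms] by metis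
qed

end

theorem theorem10:
  fixes G :: "'a pair_pre_digraph"
  assumes "pair_graph G"
    and "Digraph_Component.connected (with_proj G)"
    and "\<forall>v\<in>pverts G. open_nbhd G v \<noteq> {}"
  shows "chi_ON G \<le> 2 * treewidth G + 1 \<and>
         chi_ON G \<le> fvs G + 3 \<and>
         chi_ON G \<le> vc G + 1 \<and>
         (\<not> star_graph G \<and> \<not> edge_star_graph G \<longrightarrow> chi_ON G \<le> vc G)"
proof -
  interpret pair_graph G by fact
  obtain S where S: "vertex_cover G S" "card S = vc G"
    and min: "\<And>S'. vertex_cover G S' \<Longrightarrow> card S \<le> card S'"
    using ex_minimum_vertex_cover by auto
  show ?thesis
    using chi_ON_le_treewidth[OF assms(3)] chi_ON_le_fvs[OF assms(3)]
      chi_ON_le_vertex_cover_Suc[OF assms(3) S(1)]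
      chi_ON_le_vertex_cover[OF assms(3) S(1) min] S(2) by auto
qed

end
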